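(* Let $\pi=(\pi_i)_{i\ge0}$ be a supercritical probability distribution on $\mathbb{Z}_+$ with generating series $f_\pi(s)=\sum_{i\ge0}\pi_is^i$. Let $t'_{\max}$ be the unique root between $0$ and $1-\pi_0$ of the equation $\frac{f_\pi''(f_\pi^{-1}(1-t))}{f_\pi'(1)}=1$. For $0\le t\le t'_{\max}$ and $0\le s\le1$ let $$f(t,s)=f_\pi\!\left(f_\pi^{-1}(1-t)-(1-s)\frac{f_\pi'(f_\pi^{-1}(1-t))}{f_\pi'(1)}\right).$$ For all $0\le t\le t'_{\max}$ and $i\ge0$, let $\zeta_i(t)=[s^i]f(t,s)$ be the coefficient of $s^i$ in $f(t,s)$. Then $(\zeta_i)_{i\ge0}$ is a solution of the infinite system of differential equations $$\frac{\mathrm d\zeta_i}{\mathrm dt}=-\frac{i\zeta_i}{\sum_{j\ge0}j\zeta_j}+\frac1{\sum_{j\ge0}j\zeta_j}\left(1-\frac{\sum_{j\ge0}(j-1)j\zeta_j}{\sum_{j\ge0}j\zeta_j}\right)\big(i\zeta_i-(i+1)\zeta_{i+1}\big),\qquad \zeta_i(0)=\pi_i,\qquad i\ge0.$$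
   Context: A probability distribution $\pi$ on $\mathbb{Z}_+$ with $\sum_kk^2\pi_k<\infty$ is supercritical if $f_\pi''(1)/f_\pi'(1)>1$. $f_\pi^{-1}$ denotes the inverse of $f_\pi:[0,1]\to[\pi_0,1]$. *)

theory Defs
  imports "HOL-Probability.Probability"
begin

definition gen_series :: "nat pmf \<Rightarrow> real \<Rightarrow> real" where
  "gen_series \<pi> s = (\<Sum>k. pmf \<pi> k * s ^ k)"

text \<open>The radius of convergence may be exactly 1, so all derivatives are taken within the unit
  interval: they are one-sided at the end points, in particular at 1.\<close>

definition gen_series' :: "nat pmf \<Rightarrow> real \<Rightarrow> real" where
  "gen_series' \<pi> s = vector_derivative (gen_series \<pi>) (at s within {0..1})"

definition gen_series'' :: "nat pmf \<Rightarrow> real \<Rightarrow> real" where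
  "gen_series'' \<pi> s = vector_derivative (gen_series' \<pi>) (at s within {0..1})"

definition gen_series_inv :: "nat pmf \<Rightarrow> real \<Rightarrow> real" where
  "gen_series_inv \<pi> = the_inv_into {0..1} (gen_series \<pi>)"

text \<open>Since \<open>x / 0 = 0\<close>, the inequality forces the mean \<open>gen_series' \<pi> 1\<close> to be nonzero.\<close>

definition supercritical :: "nat pmf \<Rightarrow> bool" where
  "supercritical \<pi> \<longleftrightarrow>
     summable (\<lambda>k. (real k)\<^sup>2 * pmf \<pi> k) \<and> gen_series'' \<pi> 1 / gen_series' \<pi> 1 > 1"

definition is_critical_time :: "nat pmf \<Rightarrow> real \<Rightarrow> bool" where
  "is_critical_time \<pi> t \<longleftrightarrow>
     0 \<le> t \<and> t \<le> 1 - pmf \<pi> 0 \<and>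
     gen_series'' \<pi> (gen_series_inv \<pi> (1 - t)) / gen_series' \<pi> 1 = 1"

definition t_max :: "nat pmf \<Rightarrow> real" where
  "t_max \<pi> = (THE t. is_critical_time \<pi> t)"

definition evolved_series :: "nat pmf \<Rightarrow> real \<Rightarrow> real \<Rightarrow> real" where
  "evolved_series \<pi> t s =
     (let y = gen_series_inv \<pi> (1 - t)
      in gen_series \<pi> (y - (1 - s) * (gen_series' \<pi> y / gen_series' \<pi> 1)))"

definition is_power_series_on_unit :: "(nat \<Rightarrow> real) \<Rightarrow> (real \<Rightarrow> real) \<Rightarrow> bool" where
  "is_power_series_on_unit c g \<longleftrightarrow> (\<forall>s\<in>{0..1}. (\<lambda>i. c i * s ^ i) sums g s)"

definition zeta :: "nat pmf \<Rightarrow> nat \<Rightarrow> real \<Rightarrow> real" where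
  "zeta \<pi> i t = (THE c. is_power_series_on_unit c (evolved_series \<pi> t)) i"

text \<open>The first three conditions at each time say that the infinite sums and the quotients in the
  differential equation are meaningful. Derivatives are one-sided at the end points of \<open>{0..T}\<close>.\<close>

definition solves_system :: "nat pmf \<Rightarrow> real \<Rightarrow> (nat \<Rightarrow> real \<Rightarrow> real) \<Rightarrow> bool" where
  "solves_system \<pi> T \<zeta> \<longleftrightarrow>
     (\<forall>i. \<zeta> i 0 = pmf \<pi> i) \<and>
     (\<forall>t\<in>{0..T}.
        summable (\<lambda>j. real j * \<zeta> j t) \<and>
        summable (\<lambda>j. (real j - 1) * real j * \<zeta> j t) \<and>
        (\<Sum>j. real j * \<zeta> j t) \<noteq> 0 \<and>
        (\<forall>i. (\<zeta> i has_real_derivative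
            - (real i * \<zeta> i t) / (\<Sum>j. real j * \<zeta> j t)
            + 1 / (\<Sum>j. real j * \<zeta> j t)
              * (1 - (\<Sum>j. (real j - 1) * real j * \<zeta> j t) / (\<Sum>j. real j * \<zeta> j t))
              * (real i * \<zeta> i t - real (i + 1) * \<zeta> (i + 1) t))
          (at t within {0..T})))"

end

theory Submission imports Defs
begin

text \<open>Put \<open>y = f\<^sup>-\<^sup>1 (1 - t)\<close>, \<open>m = f' 1\<close>, \<open>b = f' y / m\<close> and \<open>a = y - b\<close>. Then the evolved series at \<open>t\<close> is
  \<open>f (a + b s)\<close>, and up to the critical time \<open>0 \<le> a < 1\<close>: on \<open>[y\<^sub>c, 1]\<close>, where \<open>f'' \<ge> m\<close>, the function
  \<open>y - f' y / m\<close> decreases to \<open>0\<close>. Since all coefficients are nonnegative, the double series can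
  be rearranged, so \<open>\<zeta>\<^sub>i = b ^ i * f\<^sup>(\<^sup>i\<^sup>) a / i!\<close>, and the factorial moments of \<open>\<zeta>\<close> are \<open>b f' y\<close> and
  \<open>b\<^sup>2 f'' y\<close>. The system then follows from the chain rule and \<open>dy/dt = - 1 / f' y\<close>.\<close>

section \<open>Power series and their re-expansion about another point\<close>

definition powser :: "(nat \<Rightarrow> real) \<Rightarrow> real \<Rightarrow> real" where
  "powser c x = (\<Sum>n. c n * x ^ n)"

text \<open>These are the coefficients of the \<open>i\<close>-th derivative divided by
  \<open>i!\<close>, so \<open>taylor c i a\<close> is the \<open>i\<close>-th Taylor coefficient at
  \<open>a\<close>.\<close>

definition taylor_coeff :: "(nat \<Rightarrow> real) \<Rightarrow> nat \<Rightarrow> nat \<Rightarrow> real" where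
  "taylor_coeff c i n = real ((n + i) choose i) * c (n + i)"

definition taylor :: "(nat \<Rightarrow> real) \<Rightarrow> nat \<Rightarrow> real \<Rightarrow> real" where
  "taylor c i = powser (taylor_coeff c i)"

lemma taylor_0: "taylor c 0 = powser c"
proof -
  have "taylor_coeff c 0 = c"
    by (simp add: taylor_coeff_def fun_eq_iff)
  then show ?thesis by (simp add: taylor_def)
qed

text \<open>Tonelli for series: nonnegativity and the finite total make the double family summable
  over the product, where the order of summation can be exchanged.\<close>

lemma sums_swap_nonneg:
  fixes u :: "nat \<Rightarrow> nat \<Rightarrow> real"
  assumes nonneg: "\<And>k j. 0 \<le> u k j"
    and rows: "\<And>k. u k sums r k" and total: "r sums R"
  shows "summable (\<lambda>k. u k j)" and "(\<lambda>j. \<Sum>k. u k j) sums R"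
proof -
  have r_nonneg: "0 \<le> r k" for k
    using rows[of k] nonneg by (metis sums_le sums_zero)
  have rows': "(u k has_sum r k) UNIV" for k
    by (rule sums_nonneg_imp_has_sum[OF rows nonneg])
  have total': "(r has_sum R) UNIV"
    by (rule sums_nonneg_imp_has_sum[OF total r_nonneg])
  have summ: "(\<lambda>(k, j). u k j) summable_on UNIV \<times> UNIV"
    by (rule summable_on_SigmaI[where g = r])
       (use rows' total' nonneg in \<open>auto simp: summable_on_def\<close>)
  have "((\<lambda>(k, j). u k j) has_sum R) (UNIV \<times> UNIV)"
    by (rule has_sum_SigmaI[where g = r]) (use rows' total' summ in auto)
  then have swapped: "((\<lambda>(j, k). u k j) has_sum R) (UNIV \<times> UNIV)"
    by (subst (asm) has_sum_swap) simp
  have cols: "(\<lambda>k. u k j) summable_on UNIV" for j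
    by (rule summable_on_SigmaD1[where f = "\<lambda>j k. u k j" and A = UNIV])
       (use swapped in \<open>auto simp: summable_on_def\<close>)
  then show col: "summable (\<lambda>k. u k j)" for j
    by (rule summable_on_imp_summable)
  have "((\<lambda>k. u k j) has_sum (\<Sum>k. u k j)) UNIV" for j
    using summable_sums[OF col] nonneg by (rule sums_nonneg_imp_has_sum)
  then have "((\<lambda>j. \<Sum>k. u k j) has_sum R) UNIV"
    using has_sum_SigmaD[OF swapped] by simp
  then show "(\<lambda>j. \<Sum>k. u k j) sums R"
    by (rule has_sum_imp_sums)
qed

lemma summable_powser_unit:
  fixes c :: "nat \<Rightarrow> real"
  assumes "\<And>n. 0 \<le> c n" "summable c" "x \<in> {0..1}"
  shows "summable (\<lambda>n. c n * x ^ n)"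
proof (rule summable_comparison_test'[OF assms(2)])
  show "norm (c n * x ^ n) \<le> c n" for n
    using assms by (auto simp: abs_mult intro!: mult_left_le power_le_one)
qed

text \<open>Expand each \<open>(a + b) ^ k\<close> by the binomial theorem and collect powers of
  \<open>b\<close>. The rearrangement rests on nonnegativity alone, so it also covers
  \<open>a + b = 1\<close>, which may be the radius of convergence.\<close>

lemma taylor_sums:
  assumes c: "\<And>n. 0 \<le> c n" "summable c" and ab: "0 \<le> a" "0 < b" "a + b \<le> 1"
  shows "(\<lambda>j. b ^ j * taylor c j a) sums powser c (a + b)"
proof -
  define u where "u k j = c k * (real (k choose j) * b ^ j * a ^ (k - j))" for k j
  have rows: "u k sums (c k * (a + b) ^ k)" for k
  proof -
    have "u k sums (\<Sum>j\<le>k. u k j)"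
      by (rule sums_finite) (auto simp: u_def)
    also have "(\<Sum>j\<le>k. u k j) = c k * (b + a) ^ k"
      by (subst binomial_ring) (simp add: u_def sum_distrib_left)
    finally show ?thesis by (simp add: add.commute)
  qed
  have total: "(\<lambda>k. c k * (a + b) ^ k) sums powser c (a + b)"
    unfolding powser_def by (rule summable_sums[OF summable_powser_unit]) (use c ab in auto)
  have nonneg: "0 \<le> u k j" for k j
    using c ab by (auto simp: u_def)
  note swap = sums_swap_nonneg[where u = u, OF nonneg rows total]
  have "(\<Sum>k. u k j) = b ^ j * taylor c j a" for j
  proof -
    \<comment> \<open>For \<open>k < j\<close> the binomial coefficient is zero, so the column
      starts at \<open>k = j\<close>.\<close>
    have "(\<Sum>k. u k j) = (\<Sum>n. u (n + j) j)"
      by (subst suminf_split_initial_segment[OF swap(1), of _ j]) (auto simp: u_def intro!: sum.neutral)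
    also have "(\<lambda>n. u (n + j) j) = (\<lambda>n. b ^ j * (real ((n + j) choose j) * c (n + j) * a ^ n))"
      by (auto simp: u_def)
    also have "suminf \<dots> = b ^ j * taylor c j a"
      unfolding taylor_def powser_def taylor_coeff_def
    proof (rule suminf_mult)
      \<comment> \<open>The column is already summable; dividing by \<open>b ^ j\<close>, which is
        nonzero as \<open>0 < b\<close>, leaves the Taylor series at \<open>a\<close>.\<close>
      have "summable (\<lambda>n. u (n + j) j / b ^ j)"
        by (intro summable_divide summable_ignore_initial_segment swap)
      then show "summable (\<lambda>n. real ((n + j) choose j) * c (n + j) * a ^ n)"
        by (rule summable_cong[THEN iffD1, rotated])
           (use ab in \<open>auto simp: u_def intro!: always_eventually\<close>)
    qed
    finally show ?thesis .
  qed
  with swap(2) show ?thesis by simp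
qed

lemma taylor_coeff_diffs: "taylor_coeff (diffs c) i n = real (Suc i) * taylor_coeff c (Suc i) n"
proof -
  have "real (Suc (n + i)) * real ((n + i) choose i)
      = real (Suc i) * real (Suc (n + i) choose Suc i)"
    by (metis Suc_times_binomial of_nat_mult)
  then show ?thesis
    by (simp add: taylor_coeff_def diffs_def algebra_simps del: of_nat_Suc binomial_Suc_Suc)
qed

text \<open>Absorption of binomial coefficients, as for the preceding identity: differentiating
  before or after taking Taylor coefficients raises the order by one and yields the same factor
  \<open>Suc i\<close>.\<close>

lemma diffs_taylor_coeff: "diffs (taylor_coeff c i) n = real (Suc i) * taylor_coeff c (Suc i) n"
proof -
  have "Suc i * (Suc (n + i) choose Suc i) = Suc n * (Suc (n + i) choose i)"
    using binomial_absorb_comp[of "Suc (n+i)" i] Suc_times_binomial[of i "n + i"]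
    by (simp del: binomial_Suc_Suc mult_Suc add: Suc_diff_le)
  then have "real (Suc i) * real (Suc (n + i) choose Suc i)
      = real (Suc n) * real (Suc (n + i) choose i)"
    by (metis of_nat_mult)
  then show ?thesis
    by (simp add: taylor_coeff_def diffs_def algebra_simps del: of_nat_Suc binomial_Suc_Suc)
qed

text \<open>Termwise differentiation preserves convergence in the open unit disc. The induction
  keeps \<open>x\<close> arbitrary because each step needs convergence on the whole disc.\<close>

lemma summable_taylor:
  assumes "summable c" "\<bar>x\<bar> < 1"
  shows "summable (\<lambda>n. taylor_coeff c i n * x ^ n)"
  using assms(2)
proof (induction i arbitrary: x)
  case 0
  then show ?case
    using powser_inside[of c 1 x] assms(1) by (simp add: taylor_coeff_def)
next
  case (Suc i)
  have "summable (\<lambda>n. diffs (taylor_coeff c i) n * x ^ n)"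
    by (rule termdiff_converges[where K = 1]) (use Suc in auto)
  then show ?case
    by (simp only: diffs_taylor_coeff mult.assoc summable_cmult_iff) simp
qed

lemma taylor_diffs:
  assumes "summable c" "\<bar>x\<bar> < 1"
  shows "taylor (diffs c) i x = real (Suc i) * taylor c (Suc i) x"
  unfolding taylor_def powser_def taylor_coeff_diffs mult.assoc
  by (rule suminf_mult[OF summable_taylor[OF assms]])

lemma taylor_has_derivative:
  assumes "summable c" "\<bar>x\<bar> < 1"
  shows "(taylor c i has_real_derivative real (Suc i) * taylor c (Suc i) x) (at x)"
proof -
  have "((\<lambda>x. \<Sum>n. taylor_coeff c i n * x ^ n) has_real_derivative
      (\<Sum>n. diffs (taylor_coeff c i) n * x ^ n)) (at x)"
    by (rule termdiffs_strong'[where K = 1]) (use assms in \<open>auto intro: summable_taylor\<close>)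
  also have "(\<Sum>n. diffs (taylor_coeff c i) n * x ^ n) = real (Suc i) * taylor c (Suc i) x"
    unfolding taylor_def powser_def diffs_taylor_coeff mult.assoc
    by (rule suminf_mult[OF summable_taylor[OF assms]])
  finally show ?thesis
    unfolding taylor_def powser_def .
qed

section \<open>Nonnegative coefficients: behaviour on the closed unit interval\<close>

lemma uniform_limit_powser_unit:
  assumes "\<And>n. 0 \<le> c n" "summable c"
  shows "uniform_limit {0..1} (\<lambda>n x. \<Sum>i<n. c i * x ^ i) (powser c) sequentially"
  unfolding powser_def
  by (rule Weierstrass_m_test[OF _ assms(2)])
     (use assms(1) in \<open>auto simp: abs_mult intro!: mult_left_le power_le_one\<close>)

lemma continuous_on_powser_unit:
  assumes "\<And>n. 0 \<le> c n" "summable c"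
  shows "continuous_on {0..1} (powser c)"
  by (rule uniform_limit_theorem[OF _ uniform_limit_powser_unit[OF assms]])
     (auto intro!: continuous_intros always_eventually)

lemma summable_of_diffs:
  fixes c :: "nat \<Rightarrow> real"
  assumes "\<And>n. 0 \<le> c n" "summable (diffs c)"
  shows "summable c"
proof -
  have "summable (\<lambda>n. c (Suc n))"
    by (rule summable_comparison_test'[OF assms(2)])
       (use assms(1) in \<open>auto simp: diffs_def algebra_simps\<close>)
  then show ?thesis by (subst (asm) summable_Suc_iff)
qed

text \<open>The majorant \<open>c n * real n\<close> makes the differentiated partial sums converge
  uniformly on the closed interval, so termwise differentiation reaches the end point 1.\<close>

lemma powser_has_derivative_unit:
  assumes c: "\<And>n. 0 \<le> c n" "summable (diffs c)" and x: "x \<in> {0..1}"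
  shows "(powser c has_real_derivative powser (diffs c) x) (at x within {0..1})"
proof -
  \<comment> \<open>The index stays aligned with the original series; the term at 0 vanishes, and
    dropping it gives \<open>diffs c\<close>.\<close>
  define g' where "g' = (\<lambda>x. \<Sum>n. c n * (real n * x ^ (n - 1)))"
  have summ: "summable (\<lambda>n. c n * real n)"
    by (subst summable_Suc_iff[symmetric]) (use c(2) in \<open>simp add: diffs_def algebra_simps\<close>)
  have bound: "norm (c n * (real n * y ^ (n - 1))) \<le> c n * real n" if "y \<in> {0..1}" for n y
    using c(1) that by (auto simp: abs_mult intro!: mult_left_mono mult_left_le power_le_one)
  have lim: "uniform_limit {0..1} (\<lambda>n x. \<Sum>i<n. c i * (real i * x ^ (i - 1))) g' sequentially"
    unfolding g'_def by (rule Weierstrass_m_test[OF bound summ])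
  have "\<exists>g. \<forall>x\<in>{0..1}. (\<lambda>n. c n * x ^ n) sums g x \<and>
      (g has_real_derivative g' x) (at x within {0..1})"
    by (rule has_field_derivative_series[OF _ _ lim, where ?x0.0 = 1])
       (auto intro!: derivative_eq_intros summable_of_diffs[OF c])
  then obtain g where g: "\<And>x. x \<in> {0..1} \<Longrightarrow> (\<lambda>n. c n * x ^ n) sums g x"
    "\<And>x. x \<in> {0..1} \<Longrightarrow> (g has_real_derivative g' x) (at x within {0..1})"
    by blast
  have "summable (\<lambda>n. c n * (real n * x ^ (n - 1)))"
    by (rule summable_comparison_test'[OF summ bound[OF x]])
  then have "g' x = powser (diffs c) x"
    unfolding g'_def powser_def
    using suminf_split_head[of "\<lambda>n. c n * (real n * x ^ (n - 1))"]
    by (simp add: diffs_def algebra_simps)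
  moreover have "(powser c has_real_derivative g' x) (at x within {0..1})"
    by (rule has_field_derivative_transform_within[OF g(2)[OF x] zero_less_one x])
       (use g(1) in \<open>auto simp: powser_def sums_iff\<close>)
  ultimately show ?thesis by simp
qed

text \<open>All termwise differences are nonnegative, and the one at \<open>k\<close> is
  positive.\<close>

lemma powser_strict_mono_unit:
  assumes c: "\<And>n. 0 \<le> c n" "summable c" and k: "0 < k" "0 < c k"
    and xy: "0 \<le> x" "x < y" "y \<le> 1"
  shows "powser c x < powser c y"
proof -
  have sx: "summable (\<lambda>n. c n * x ^ n)" and sy: "summable (\<lambda>n. c n * y ^ n)"
    by (rule summable_powser_unit[OF c]; use xy in simp)+
  have "0 < (\<Sum>n. c n * y ^ n - c n * x ^ n)"
  proof (rule suminf_pos2)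
    show "summable (\<lambda>n. c n * y ^ n - c n * x ^ n)"
      using sy sx by (rule summable_diff)
    show "0 \<le> c n * y ^ n - c n * x ^ n" for n
      using c(1) xy by (simp add: mult_left_mono power_mono)
    show "0 < c k * y ^ k - c k * x ^ k"
      using k xy by (simp add: power_strict_mono)
  qed
  also have "\<dots> = powser c y - powser c x"
    unfolding powser_def by (rule suminf_diff[OF sy sx, symmetric])
  finally show ?thesis by simp
qed

lemma powser_0: "powser c 0 = c 0"
  unfolding powser_def using powser_zero[of c] by simp

lemma powser_1: "powser c 1 = suminf c"
  by (simp add: powser_def)

lemma powser_nonneg:
  assumes "\<And>n. 0 \<le> c n" "summable c" "x \<in> {0..1}"
  shows "0 \<le> powser c x"
  unfolding powser_def
  by (rule suminf_nonneg[OF summable_powser_unit[OF assms]]) (use assms in auto)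

section \<open>Uniqueness of the coefficients\<close>

lemma powser_coeff_0:
  fixes e :: "nat \<Rightarrow> real"
  assumes "\<And>s. 0 < s \<Longrightarrow> s \<le> 1 \<Longrightarrow> (\<lambda>n. e n * s ^ n) sums 0"
  shows "e 0 = 0"
proof -
  have "isCont (powser e) 0"
    unfolding powser_def
    by (rule isCont_powser[where K = 1]) (use assms[of 1] in \<open>auto simp: sums_iff\<close>)
  then have "(powser e \<longlongrightarrow> e 0) (at_right 0)"
    by (metis isCont_def powser_0 tendsto_within_subset subset_UNIV)
  moreover have "eventually (\<lambda>s. powser e s = 0) (at_right 0)"
    by (rule eventually_at_rightI[of 0 1]) (use assms in \<open>auto simp: powser_def sums_iff\<close>)
  ultimately have "((\<lambda>_. 0) \<longlongrightarrow> e 0) (at_right (0::real))"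
    using filterlim_cong by fastforce
  then show ?thesis
    using tendsto_const_iff trivial_limit_at_right_real by metis
qed

text \<open>Once the constant term is known to vanish, dividing by \<open>s\<close> shifts the
  sequence. Assuming the sums only for \<open>0 < s\<close> lets the hypothesis survive this
  division.\<close>

lemma powser_coeffs_zero:
  fixes e :: "nat \<Rightarrow> real"
  assumes "\<And>s. 0 < s \<Longrightarrow> s \<le> 1 \<Longrightarrow> (\<lambda>n. e n * s ^ n) sums 0"
  shows "e n = 0"
  using assms
proof (induction n arbitrary: e)
  case 0
  then show ?case by (rule powser_coeff_0)
next
  case (Suc n e)
  have e0: "e 0 = 0"
    by (rule powser_coeff_0[OF Suc.prems])
  show ?case
  proof (rule Suc.IH)
    fix s :: real assume s: "0 < s" "s \<le> 1"
    have "(\<lambda>n. e (Suc n) * s ^ Suc n) sums 0"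
      using Suc.prems[OF s] e0 by (subst sums_Suc_iff) simp
    then have "(\<lambda>n. (e (Suc n) * s ^ Suc n) / s) sums (0 / s)"
      by (rule sums_divide)
    then show "(\<lambda>n. e (Suc n) * s ^ n) sums 0"
      using s by simp
  qed
qed

lemma is_power_series_on_unit_unique:
  assumes "is_power_series_on_unit c g" "is_power_series_on_unit d g"
  shows "c = d"
proof
  fix n
  have "c n - d n = 0"
  proof (rule powser_coeffs_zero)
    fix s :: real assume "0 < s" "s \<le> 1"
    then have "(\<lambda>n. c n * s ^ n - d n * s ^ n) sums (g s - g s)"
      using assms unfolding is_power_series_on_unit_def by (intro sums_diff) auto
    then show "(\<lambda>n. (c n - d n) * s ^ n) sums 0"
      by (simp add: algebra_simps)
  qed
  then show "c n = d n" by simp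
qed

lemma pmf_sums_1: "pmf (\<pi> :: nat pmf) sums 1"
  using sums_infsetsum_nat'[OF pmf_abs_summable] infsetsum_pmf_eq_1[of \<pi> UNIV] by (metis subset_UNIV)

lemma vector_derivative_unit:
  assumes "(f has_real_derivative d) (at x within {0..1})" "x \<in> {0..1}"
  shows "vector_derivative f (at x within {0..1}) = d"
  using assms by (intro vector_derivative_within_closed_interval)
    (auto simp: has_real_derivative_iff_has_vector_derivative)

section \<open>The generating function and its first two derivatives\<close>

locale supercritical_pmf =
  fixes \<pi> :: "nat pmf"
  assumes supercritical: "supercritical \<pi>"
begin

abbreviation p where "p \<equiv> pmf \<pi>"
abbreviation F where "F \<equiv> powser p"
abbreviation F' where "F' \<equiv> powser (diffs p)"
abbreviation F'' where "F'' \<equiv> powser (diffs (diffs p))"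
abbreviation m where "m \<equiv> F' 1"

lemma diffs_nonneg: "0 \<le> diffs p n" "0 \<le> diffs (diffs p) n"
  by (simp_all add: diffs_def)

lemma summable_diffs2: "summable (diffs (diffs p))"
proof -
  have "summable (\<lambda>n. (real (n + 2))\<^sup>2 * p (n + 2))"
    using supercritical unfolding supercritical_def
    by (intro summable_ignore_initial_segment[where f = "\<lambda>k. (real k)\<^sup>2 * p k"]) simp
  then show ?thesis
  proof (rule summable_comparison_test')
    fix n
    have "real (Suc n) * real (Suc (Suc n)) * p (Suc (Suc n)) \<le> (real (n + 2))\<^sup>2 * p (n + 2)"
      unfolding power2_eq_square by (auto intro!: mult_right_mono)
    then show "norm (diffs (diffs p) n) \<le> (real (n + 2))\<^sup>2 * p (n + 2)"
      by (simp add: diffs_def mult.assoc abs_mult)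
  qed
qed

lemma summable_diffs: "summable (diffs p)"
  by (rule summable_of_diffs[OF diffs_nonneg(1) summable_diffs2])

lemma summable_p: "summable p"
  using pmf_sums_1 by (rule sums_summable)

lemma F_1: "F 1 = 1"
  unfolding powser_1 using pmf_sums_1 by (rule sums_unique[symmetric])

lemmas F_derivative = powser_has_derivative_unit[OF pmf_nonneg summable_diffs]
lemmas F'_derivative = powser_has_derivative_unit[OF diffs_nonneg(1) summable_diffs2]

lemma gen_series_eq: "gen_series \<pi> = F"
  by (simp add: gen_series_def powser_def fun_eq_iff)

lemma gen_series'_eq: "x \<in> {0..1} \<Longrightarrow> gen_series' \<pi> x = F' x"
  unfolding gen_series'_def gen_series_eq by (rule vector_derivative_unit[OF F_derivative])

text \<open>\<open>gen_series' \<pi>\<close> is known to agree with \<open>F'\<close> only on the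
  unit interval, which suffices for derivatives taken within it.\<close>

lemma gen_series''_eq: "x \<in> {0..1} \<Longrightarrow> gen_series'' \<pi> x = F'' x"
  unfolding gen_series''_def
  by (rule vector_derivative_unit[OF has_field_derivative_transform_within[OF F'_derivative zero_less_one]])
     (simp_all add: gen_series'_eq)

text \<open>If \<open>m\<close> were zero, the quotient in the definition of supercriticality would
  be 0 by convention, hence not above 1.\<close>

lemma m_pos: "0 < m" and F''_1_gt: "m < F'' 1"
proof -
  have "1 < F'' 1 / m"
    using supercritical by (simp add: supercritical_def gen_series'_eq gen_series''_eq)
  moreover have "0 \<le> m"
    by (rule powser_nonneg[OF diffs_nonneg(1) summable_diffs]) simp
  ultimately show "0 < m" "m < F'' 1"
    by (cases "m = 0"; simp add: field_simps)+
qed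

text \<open>With \<open>j = k + 3\<close>, this is the bound of \<open>2 * p 2 + j * p j\<close> by
  the mean, used to compare \<open>F'' 0 = 2 * p 2\<close> with \<open>m\<close>.\<close>

lemma two_diffs_le_mean: "(\<Sum>n\<in>{1, Suc (Suc k)}. diffs p n) \<le> m"
  unfolding powser_1 by (rule sum_le_suminf[OF summable_diffs]) (use diffs_nonneg in auto)

text \<open>Otherwise \<open>F\<close> is at most quadratic, so \<open>F'' 1 = 2 * p 2\<close> is at
  most the mean, against supercriticality.\<close>

lemma ex_large_offspring: "\<exists>k\<ge>3. 0 < p k"
proof (rule ccontr)
  assume "\<not> ?thesis"
  then have z: "p k = 0" if "3 \<le> k" for k
    using that by (metis less_eq_real_def pmf_nonneg)
  have "diffs (diffs p) n = 0" if "n \<notin> {0}" for n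
    using that by (auto simp: diffs_def intro!: z)
  then have "F'' 1 = diffs (diffs p) 0"
    unfolding powser_1 by (subst suminf_finite[of "{0}"]) auto
  also have "\<dots> \<le> m"
    using two_diffs_le_mean[of 0] diffs_nonneg(1)[of 2] by (simp add: diffs_def[of "diffs p"] numeral_2_eq_2)
  finally show False
    using F''_1_gt by simp
qed

text \<open>Some \<open>k * p k\<close> with \<open>3 \<le> k\<close> is positive and contributes to
  the mean besides \<open>2 * p 2\<close>.\<close>

lemma two_diffs_le_meanss: "F'' 0 < m"
proof -
  obtain k where k: "k \<ge> 3" "0 < p k"
    using ex_large_offspring by blast
  define l where "l = k - 3"
  with k have l: "k = Suc (Suc (Suc l))" by simp
  then have "0 < diffs p (Suc (Suc l))"
    using k by (simp add: diffs_def)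
  then show ?thesis
    using two_diffs_le_mean[of l] by (simp add: powser_0 diffs_def numeral_2_eq_2)
qed

text \<open>A positive \<open>p k\<close> with \<open>3 \<le> k\<close> remains a positive
  coefficient of positive index after up to two differentiations, which serves \<open>F\<close>,
  \<open>F'\<close> and \<open>F''\<close> alike.\<close>

lemma F_strict_mono: "0 \<le> x \<Longrightarrow> x < y \<Longrightarrow> y \<le> 1 \<Longrightarrow> F x < F y"
proof -
  obtain k where "k \<ge> 3" "0 < p k"
    using ex_large_offspring by blast
  then have "0 < k" "0 < p k"
    by auto
  then show "0 \<le> x \<Longrightarrow> x < y \<Longrightarrow> y \<le> 1 \<Longrightarrow> F x < F y"
    by (rule powser_strict_mono_unit[OF pmf_nonneg summable_p])
qed

lemma F'_strict_mono: "0 \<le> x \<Longrightarrow> x < y \<Longrightarrow> y \<le> 1 \<Longrightarrow> F' x < F' y"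
proof -
  obtain k where "k \<ge> 3" "0 < p k"
    using ex_large_offspring by blast
  then have "0 < k - 1" "0 < diffs p (k - 1)"
    by (auto simp: diffs_def)
  then show "0 \<le> x \<Longrightarrow> x < y \<Longrightarrow> y \<le> 1 \<Longrightarrow> F' x < F' y"
    by (rule powser_strict_mono_unit[OF diffs_nonneg(1) summable_diffs])
qed

lemma F''_strict_mono: "0 \<le> x \<Longrightarrow> x < y \<Longrightarrow> y \<le> 1 \<Longrightarrow> F'' x < F'' y"
proof -
  obtain k where k: "k \<ge> 3" "0 < p k"
    using ex_large_offspring by blast
  then have "Suc (Suc (k - 2)) = k" by simp
  with k have "0 < k - 2" "0 < diffs (diffs p) (k - 2)"
    by (auto simp: diffs_def)
  then show "0 \<le> x \<Longrightarrow> x < y \<Longrightarrow> y \<le> 1 \<Longrightarrow> F'' x < F'' y"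
    by (rule powser_strict_mono_unit[OF diffs_nonneg(2) summable_diffs2])
qed

lemma F_inj: "inj_on F {0..1}"
  by (rule linorder_inj_onI) (use F_strict_mono in fastforce)+

lemma F_continuous: "continuous_on {0..1} F"
  by (rule continuous_on_powser_unit[OF pmf_nonneg summable_p])

section \<open>The inverse function and the critical time\<close>

definition Y where "Y t = gen_series_inv \<pi> (1 - t)"

lemma Y_F: "x \<in> {0..1} \<Longrightarrow> Y (1 - F x) = x"
  by (simp add: Y_def gen_series_inv_def gen_series_eq the_inv_into_f_f[OF F_inj])

lemma obtain_Y:
  assumes "0 \<le> t" "t \<le> 1 - p 0"
  obtains "Y t \<in> {0..1}" "F (Y t) = 1 - t"
proof -
  obtain x where "0 \<le> x" "x \<le> 1" "F x = 1 - t"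
    using IVT'[of F 0 "1 - t" 1] assms F_continuous by (auto simp: powser_0 F_1)
  moreover from this have "Y t = x"
    using Y_F[of x] by simp
  ultimately show ?thesis using that by simp
qed

text \<open>Intermediate value theorem, from \<open>F'' 0 < m < F'' 1\<close>. Positivity of the
  point later keeps \<open>F' (Y t)\<close> away from zero.\<close>

lemma ex_critical_point: "\<exists>y. 0 < y \<and> y \<le> 1 \<and> F'' y = m"
proof -
  obtain y where y: "0 \<le> y" "y \<le> 1" "F'' y = m"
    using IVT'[of F'' 0 m 1] two_diffs_le_meanss F''_1_gt
      continuous_on_powser_unit[OF diffs_nonneg(2) summable_diffs2] by auto
  then have "y \<noteq> 0" using two_diffs_le_meanss by (metis less_irrefl)
  with y show ?thesis by (intro exI[of _ y]) simp
qed

definition y\<^sub>c where "y\<^sub>c = (SOME y. 0 < y \<and> y \<le> 1 \<and> F'' y = m)"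

lemma y\<^sub>c: "0 < y\<^sub>c" "y\<^sub>c \<le> 1" "F'' y\<^sub>c = m"
  unfolding y\<^sub>c_def using someI_ex[OF ex_critical_point] by auto

lemma F_bounds:
  assumes "x \<in> {0..1}"
  shows "p 0 \<le> F x" "F x \<le> 1"
  using F_strict_mono[of 0 x] F_strict_mono[of x 1] assms powser_0[of p] F_1
  by (cases "x = 0"; cases "x = 1"; force)+

text \<open>Strict monotonicity of \<open>F''\<close> identifies \<open>Y t\<close> with
  \<open>y\<^sub>c\<close>. The equivalence yields existence and uniqueness of the critical time at
  once, and the value of \<open>t_max \<pi>\<close>.\<close>

lemma is_critical_time_iff: "is_critical_time \<pi> t \<longleftrightarrow> t = 1 - F y\<^sub>c"
proof
  assume t: "is_critical_time \<pi> t"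
  then have "0 \<le> t" "t \<le> 1 - p 0"
    by (auto simp: is_critical_time_def)
  then obtain Y: "Y t \<in> {0..1}" "F (Y t) = 1 - t"
    by (rule obtain_Y)
  then have "F'' (Y t) = m"
    using t m_pos by (simp add: is_critical_time_def gen_series''_eq gen_series'_eq flip: Y_def)
  then have "Y t = y\<^sub>c"
    using F''_strict_mono[of "Y t" "y\<^sub>c"] F''_strict_mono[of "y\<^sub>c" "Y t"] Y y\<^sub>c
    by (cases "Y t" "y\<^sub>c" rule: linorder_cases) auto
  with Y show "t = 1 - F y\<^sub>c" by simp
next
  assume t: "t = 1 - F y\<^sub>c"
  then have "gen_series_inv \<pi> (1 - t) = y\<^sub>c"
    using Y_F[of "y\<^sub>c"] y\<^sub>c by (simp add: Y_def)
  then show "is_critical_time \<pi> t"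
    unfolding is_critical_time_def
    using t F_bounds[of "y\<^sub>c"] y\<^sub>c m_pos by (simp add: gen_series''_eq gen_series'_eq)
qed

lemma t_max_eq: "t_max \<pi> = 1 - F y\<^sub>c"
  unfolding t_max_def is_critical_time_iff by simp

section \<open>The coefficients of the evolved series and their moments\<close>

definition b where "b t = F' (Y t) / m"
definition a where "a t = Y t - b t"
definition z where "z i t = b t ^ i * taylor p i (a t)"

lemma Y_bounds:
  assumes "t \<in> {0..t_max \<pi>}"
  shows "y\<^sub>c \<le> Y t" "Y t \<le> 1" "F (Y t) = 1 - t"
proof -
  have "0 \<le> t" "t \<le> 1 - p 0"
    using assms F_bounds[of "y\<^sub>c"] y\<^sub>c by (auto simp: t_max_eq)
  then obtain Y: "Y t \<in> {0..1}" "F (Y t) = 1 - t"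
    by (rule obtain_Y)
  then show "Y t \<le> 1" "F (Y t) = 1 - t" by auto
  show "y\<^sub>c \<le> Y t"
    using F_strict_mono[of "Y t" "y\<^sub>c"] Y y\<^sub>c assms by (force simp: t_max_eq)
qed

lemma Y_unit: "t \<in> {0..t_max \<pi>} \<Longrightarrow> Y t \<in> {0..1}"
  using Y_bounds[of t] y\<^sub>c by simp

lemma F'_Y_pos: "t \<in> {0..t_max \<pi>} \<Longrightarrow> 0 < F' (Y t)"
  using F'_strict_mono[of 0 "Y t"] Y_bounds[of t] y\<^sub>c diffs_nonneg(1)[of 0] by (auto simp: powser_0)

lemma b_pos: "t \<in> {0..t_max \<pi>} \<Longrightarrow> 0 < b t"
  using F'_Y_pos m_pos by (simp add: b_def)

text \<open>By the mean value theorem \<open>m - F' (Y t)\<close> equals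
  \<open>F'' \<xi> * (1 - Y t)\<close>, where \<open>F'' \<xi>\<close> is at least \<open>m\<close>
  because \<open>\<xi>\<close> lies to the right of \<open>y\<^sub>c\<close>. Hence
  \<open>F' (Y t) \<le> m * Y t\<close>.\<close>

lemma a_nonneg:
  assumes t: "t \<in> {0..t_max \<pi>}"
  shows "0 \<le> a t"
proof (cases "Y t = 1")
  case True
  then show ?thesis using m_pos by (simp add: a_def b_def)
next
  case False
  then have less: "Y t < 1" and ge: "y\<^sub>c \<le> Y t"
    using Y_bounds[OF t] by auto
  have "\<exists>\<xi>\<in>{Y t<..<1}. F' 1 - F' (Y t) = F'' \<xi> * (1 - Y t)"
  proof (rule mvt_simple[OF less])
    fix x assume "Y t \<le> x" "x \<le> 1"
    then have "(F' has_real_derivative F'' x) (at x within {Y t..1})"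
      using ge y\<^sub>c by (intro DERIV_subset[OF F'_derivative]) auto
    then show "(F' has_derivative (*) (F'' x)) (at x within {Y t..1})"
      by (simp add: has_field_derivative_def)
  qed
  then obtain \<xi> where \<xi>: "Y t < \<xi>" "\<xi> < 1" "m - F' (Y t) = F'' \<xi> * (1 - Y t)"
    by auto
  have "m \<le> F'' \<xi>"
    using F''_strict_mono[of "y\<^sub>c" \<xi>] \<xi> ge y\<^sub>c by simp
  then have "m * (1 - Y t) \<le> m - F' (Y t)"
    unfolding \<xi>(3) using less by (intro mult_right_mono) auto
  then have "F' (Y t) \<le> m * Y t"
    by (simp add: algebra_simps)
  then show ?thesis
    using m_pos by (simp add: a_def b_def field_simps)
qed

lemma a_less_1: "t \<in> {0..t_max \<pi>} \<Longrightarrow> a t < 1"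
  using b_pos[of t] Y_bounds[of t] by (simp add: a_def)

lemma abs_a_less_1: "t \<in> {0..t_max \<pi>} \<Longrightarrow> \<bar>a t\<bar> < 1"
  using a_less_1 a_nonneg by auto

lemma a_plus_b: "a t + b t = Y t"
  by (simp add: a_def)

lemma z_power_series:
  assumes t: "t \<in> {0..t_max \<pi>}"
  shows "is_power_series_on_unit (\<lambda>i. z i t) (evolved_series \<pi> t)"
  unfolding is_power_series_on_unit_def
proof
  fix s :: real assume s: "s \<in> {0..1}"
  have ev: "evolved_series \<pi> t s = F (a t + b t * s)"
    by (simp add: evolved_series_def Let_def gen_series_eq gen_series'_eq[OF Y_unit[OF t]]
          gen_series'_eq[of 1] a_def b_def algebra_simps diff_divide_distrib flip: Y_def)
  show "(\<lambda>i. z i t * s ^ i) sums evolved_series \<pi> t s"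
  \<comment> \<open>Re-expansion requires a positive increment \<open>b t * s\<close>; at
    \<open>s = 0\<close> only the constant term survives.\<close>
  proof (cases "s = 0")
    case True
    then show ?thesis
      unfolding ev using powser_sums_zero[of "\<lambda>i. z i t"]
      by (simp add: z_def taylor_0)
  next
    case False
    have "b t * s \<le> b t"
      using s b_pos[OF t] by (simp add: mult_left_le)
    then have "a t + b t * s \<le> 1"
      using a_plus_b[of t] Y_bounds(2)[OF t] by linarith
    then have "(\<lambda>i. (b t * s) ^ i * taylor p i (a t)) sums F (a t + b t * s)"
      using False s b_pos[OF t] a_nonneg[OF t]
      by (intro taylor_sums pmf_nonneg summable_p) auto
    then show ?thesis
      unfolding ev z_def by (simp add: power_mult_distrib mult.commute mult.left_commute)
  qed
qed

lemma zeta_eq: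
  assumes t: "t \<in> {0..t_max \<pi>}"
  shows "zeta \<pi> i t = z i t"
proof -
  have "(THE c. is_power_series_on_unit c (evolved_series \<pi> t)) = (\<lambda>i. z i t)"
    by (rule the_equality[where P = "\<lambda>c. is_power_series_on_unit c (evolved_series \<pi> t)",
          OF z_power_series[OF t]])
       (rule is_power_series_on_unit_unique[OF _ z_power_series[OF t]])
  then show ?thesis by (simp add: zeta_def)
qed

text \<open>Re-expanding \<open>F'\<close> about \<open>a t\<close> produces the weights
  \<open>Suc j\<close> through \<open>taylor_diffs\<close>; the missing term at 0 has weight
  zero.\<close>

lemma z_first_moment:
  assumes t: "t \<in> {0..t_max \<pi>}"
  shows "(\<lambda>j. real j * z j t) sums (b t * F' (Y t))"
proof -
  have "(\<lambda>j. b t ^ j * taylor (diffs p) j (a t)) sums F' (a t + b t)"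
    using Y_bounds[OF t] a_plus_b[of t] b_pos[OF t] a_nonneg[OF t]
    by (intro taylor_sums diffs_nonneg summable_diffs) auto
  then have "(\<lambda>j. b t * (b t ^ j * taylor (diffs p) j (a t))) sums (b t * F' (Y t))"
    unfolding a_plus_b by (rule sums_mult)
  also have "(\<lambda>j. b t * (b t ^ j * taylor (diffs p) j (a t))) = (\<lambda>j. real (Suc j) * z (Suc j) t)"
    using taylor_diffs[OF summable_p abs_a_less_1[OF t]] by (simp add: z_def fun_eq_iff algebra_simps)
  finally show ?thesis
    by (subst (asm) sums_Suc_iff) simp
qed

lemma z_second_moment:
  assumes t: "t \<in> {0..t_max \<pi>}"
  shows "(\<lambda>j. (real j - 1) * real j * z j t) sums ((b t)\<^sup>2 * F'' (Y t))"
proof -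
  have "(\<lambda>j. b t ^ j * taylor (diffs (diffs p)) j (a t)) sums F'' (a t + b t)"
    using Y_bounds[OF t] a_plus_b[of t] b_pos[OF t] a_nonneg[OF t]
    by (intro taylor_sums diffs_nonneg summable_diffs2) auto
  then have "(\<lambda>j. (b t)\<^sup>2 * (b t ^ j * taylor (diffs (diffs p)) j (a t))) sums ((b t)\<^sup>2 * F'' (Y t))"
    unfolding a_plus_b by (rule sums_mult)
  also have "(\<lambda>j. (b t)\<^sup>2 * (b t ^ j * taylor (diffs (diffs p)) j (a t)))
      = (\<lambda>j. (real (j + 2) - 1) * real (j + 2) * z (j + 2) t)"
    using taylor_diffs[OF summable_p abs_a_less_1[OF t]]
      taylor_diffs[OF summable_diffs abs_a_less_1[OF t]]
    by (simp add: z_def fun_eq_iff power2_eq_square algebra_simps)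
  finally show ?thesis
    \<comment> \<open>The terms at 0 and 1 have weight zero, so the shift by two costs
      nothing.\<close>
    by (subst (asm) sums_zero_iff_shift) (auto simp: less_2_cases_iff)
qed

section \<open>Derivatives in time and the differential system\<close>

lemma Y_derivative:
  assumes t: "t \<in> {0..t_max \<pi>}"
  shows "(Y has_real_derivative - 1 / F' (Y t)) (at t within {0..t_max \<pi>})"
proof -
  have eq: "1 - F (Y s) = s" if "s \<in> {0..t_max \<pi>}" for s
    using Y_bounds[OF that] by simp
  \<comment> \<open>The inverse of a continuous injection on a compact set is continuous. The
    inverse function rule is applied on this whole image, then restricted to the time
    interval.\<close>
  have "continuous_on ((\<lambda>x. 1 - F x) ` {0..1}) Y"
    by (rule continuous_on_inv) (auto intro!: continuous_intros F_continuous Y_F)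
  then have cont: "continuous (at (1 - F (Y t)) within (\<lambda>x. 1 - F x) ` {0..1}) Y"
    using Y_unit[OF t] by (auto simp: continuous_on_eq_continuous_within)
  have "((\<lambda>x. 1 - F x) has_real_derivative - F' (Y t)) (at (Y t) within {0..1})"
    using F_derivative[OF Y_unit[OF t]] by (auto intro!: derivative_eq_intros)
  then have "((\<lambda>x. 1 - F x) has_derivative (*) (- F' (Y t))) (at (Y t) within {0..1})"
    by (simp add: has_field_derivative_def)
  then have "(Y has_derivative (*) (- 1 / F' (Y t)))
      (at (1 - F (Y t)) within (\<lambda>x. 1 - F x) ` {0..1})"
    by (rule has_derivative_inverse_within[OF _ cont Y_unit[OF t]])
       (use F'_Y_pos[OF t] Y_F in \<open>auto simp: fun_eq_iff intro!: linearI algebra_simps\<close>)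
  then have "(Y has_real_derivative - 1 / F' (Y t)) (at t within (\<lambda>x. 1 - F x) ` {0..1})"
    by (simp add: has_field_derivative_def eq[OF t])
  moreover have "{0..t_max \<pi>} \<subseteq> (\<lambda>x. 1 - F x) ` {0..1}"
  proof
    fix s assume s: "s \<in> {0..t_max \<pi>}"
    show "s \<in> (\<lambda>x. 1 - F x) ` {0..1}"
      by (rule image_eqI[of s "\<lambda>x. 1 - F x" "Y s"]) (simp_all only: eq[OF s] Y_unit[OF s])
  qed
  ultimately show ?thesis
    by (rule DERIV_subset)
qed

lemma b_derivative:
  assumes t: "t \<in> {0..t_max \<pi>}"
  shows "(b has_real_derivative F'' (Y t) / m * (- 1 / F' (Y t))) (at t within {0..t_max \<pi>})"
proof -
  have "((F' \<circ> Y) has_real_derivative F'' (Y t) * (- 1 / F' (Y t))) (at t within {0..t_max \<pi>})"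
    by (rule DERIV_image_chain[OF DERIV_subset[OF F'_derivative[OF Y_unit[OF t]]] Y_derivative[OF t]])
       (use Y_unit in blast)
  from DERIV_cdivide[OF this, of m] show ?thesis
    by (simp add: b_def[abs_def] o_def mult.commute)
qed

lemma a_derivative:
  assumes t: "t \<in> {0..t_max \<pi>}"
  shows "(a has_real_derivative (1 - F'' (Y t) / m) * (- 1 / F' (Y t))) (at t within {0..t_max \<pi>})"
  using DERIV_diff[OF Y_derivative[OF t] b_derivative[OF t]]
  by (simp add: a_def[abs_def] algebra_simps)

text \<open>Product and chain rule. As \<open>F' (Y t) = m * b t\<close>, the first moment is
  \<open>M = m * (b t)\<^sup>2\<close>, and the ratio of the second factorial moment to it is
  \<open>F'' (Y t) / m\<close>.\<close>

lemma z_derivative: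
  assumes t: "t \<in> {0..t_max \<pi>}"
  defines "M \<equiv> b t * F' (Y t)"
  shows "(z i has_real_derivative
      - (real i * z i t) / M + 1 / M * (1 - (b t)\<^sup>2 * F'' (Y t) / M)
        * (real i * z i t - real (i + 1) * z (i + 1) t)) (at t within {0..t_max \<pi>})"
proof -
  have "((taylor p i \<circ> a) has_real_derivative
      real (Suc i) * taylor p (Suc i) (a t) * ((1 - F'' (Y t) / m) * (- 1 / F' (Y t))))
      (at t within {0..t_max \<pi>})"
    by (rule DERIV_chain[OF taylor_has_derivative[OF summable_p abs_a_less_1[OF t]] a_derivative[OF t]])
  from DERIV_mult[OF DERIV_power[OF b_derivative[OF t], of i] this]
  have der: "(z i has_real_derivative
      real i * (F'' (Y t) / m * (- 1 / F' (Y t)) * b t ^ (i - Suc 0)) * taylor p i (a t)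
      + real (Suc i) * taylor p (Suc i) (a t) * ((1 - F'' (Y t) / m) * (- 1 / F' (Y t))) * b t ^ i)
      (at t within {0..t_max \<pi>})"
    by (simp add: z_def[abs_def] o_def)
  define r where "r = F'' (Y t) / m"
  have nz: "m \<noteq> 0" "b t \<noteq> 0"
    using m_pos b_pos[OF t] by auto
  have F': "F' (Y t) = m * b t"
    using nz by (simp add: b_def)
  have M: "M = m * (b t * b t)"
    by (simp add: M_def F')
  have r: "(b t)\<^sup>2 * F'' (Y t) / M = r"
    using nz by (simp add: M r_def power2_eq_square)
  have first: "real i * (r * (- 1 / F' (Y t)) * b t ^ (i - Suc 0)) * taylor p i (a t)
      = real i * z i t * (- r / M)"
    \<comment> \<open>At \<open>i = 0\<close> the exponent is truncated to 0, but the factor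
      \<open>real i\<close> kills both sides.\<close>
    using nz by (cases i) (simp_all add: z_def F' M)
  have second: "real (Suc i) * taylor p (Suc i) (a t) * ((1 - r) * (- 1 / F' (Y t))) * b t ^ i
      = real (i + 1) * z (i + 1) t * ((1 - r) * (- 1 / M))"
    using nz by (simp add: z_def F' M)
  \<comment> \<open>Here \<open>A\<close> stands for \<open>i\<close> times \<open>z i t\<close> and
    \<open>B\<close> for \<open>i + 1\<close> times the next coefficient.\<close>
  have "- A / M + 1 / M * (1 - r) * (A - B) = A * (- r / M) + B * ((1 - r) * (- 1 / M))" for A B
    by (simp add: divide_inverse algebra_simps)
  then show ?thesis
    using der unfolding r_def[symmetric] first second r by simp
qed

lemma t_max_nonneg: "0 \<le> t_max \<pi>"
  using F_bounds[of "y\<^sub>c"] y\<^sub>c by (simp add: t_max_eq)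

text \<open>At time 0 the affine argument of \<open>F\<close> is \<open>s\<close> itself:
  \<open>a 0 = 0\<close> and \<open>b 0 = 1\<close>.\<close>

lemma z_0: "z i 0 = p i"
proof -
  have "Y 0 = 1" using Y_F[of 1] by (simp add: F_1)
  then have "b 0 = 1" "a 0 = 0"
    using m_pos by (simp_all add: a_def b_def)
  then show ?thesis
    by (simp add: z_def taylor_def powser_0 taylor_coeff_def)
qed

lemma zeta_solves_system: "solves_system \<pi> (t_max \<pi>) (zeta \<pi>)"
  unfolding solves_system_def
proof (intro conjI allI ballI)
  show "zeta \<pi> i 0 = p i" for i
    using t_max_nonneg by (simp add: zeta_eq z_0)
  fix t assume t: "t \<in> {0..t_max \<pi>}"
  note first = z_first_moment[OF t] and second = z_second_moment[OF t]
  show "summable (\<lambda>j. real j * zeta \<pi> j t)" "summable (\<lambda>j. (real j - 1) * real j * zeta \<pi> j t)"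
    using first second by (simp_all add: zeta_eq[OF t] sums_iff)
  show "(\<Sum>j. real j * zeta \<pi> j t) \<noteq> 0"
    using b_pos[OF t] F'_Y_pos[OF t] unfolding zeta_eq[OF t] sums_unique[OF first, symmetric] by simp
  show "(zeta \<pi> i has_real_derivative
      - (real i * zeta \<pi> i t) / (\<Sum>j. real j * zeta \<pi> j t)
      + 1 / (\<Sum>j. real j * zeta \<pi> j t)
        * (1 - (\<Sum>j. (real j - 1) * real j * zeta \<pi> j t) / (\<Sum>j. real j * zeta \<pi> j t))
        * (real i * zeta \<pi> i t - real (i + 1) * zeta \<pi> (i + 1) t))
      (at t within {0..t_max \<pi>})" for i
    unfolding zeta_eq[OF t] sums_unique[OF first, symmetric] sums_unique[OF second, symmetric]
    \<comment> \<open>\<open>zeta\<close> and \<open>z\<close> are identified only on the time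
      interval, which suffices for a derivative within it.\<close>
    by (rule has_field_derivative_transform_within[OF z_derivative[OF t] zero_less_one t])
       (simp add: zeta_eq)
qed

end

theorem proposition2:
  fixes \<pi> :: "nat pmf"
  assumes "supercritical \<pi>"
  shows "(\<exists>!t. is_critical_time \<pi> t) \<and>
    (\<forall>t\<in>{0..t_max \<pi>}. is_power_series_on_unit (\<lambda>i. zeta \<pi> i t) (evolved_series \<pi> t)) \<and>
    solves_system \<pi> (t_max \<pi>) (zeta \<pi>)"
proof -
  interpret supercritical_pmf \<pi>
    by unfold_locales (rule assms)
  show ?thesis
    using z_power_series zeta_solves_system by (simp add: is_critical_time_iff zeta_eq)
qed

end
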